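(* Let $\Gamma$ be any algebraically closed directed graph that is not isomorphic to the countable universal directed graph $D$. Then there exists a non-regular injective endomorphism $f$ of $D$ such that the subgraph of $D$ induced by the images of the vertices under $f$ is isomorphic to $\Gamma$ and such that the $\mathscr{D}$-class of $f$ in $\operatorname{End} D$ contains $2^{\aleph_0}$ $\mathscr{R}$-classes and $2^{\aleph_0}$ $\mathscr{L}$-classes.
   Context: A directed graph is a pair $(V,E)$ with $E$ an irreflexive binary relation on $V$. A directed graph $(V,E)$ is algebraically closed if for every finite $A\subseteq V$ there is a vertex $v$ with $(u,v),(v,u)\in E$ for all $u\in A$. The countable universal directed graph $D$ is the Fraïssé limit of the finite directed graphs. The induced subgraph on a vertex set $U$ contains all edges of $D$ between vertices of $U$. Green's relations on $M=\operatorname{End} D$: $f\,\mathscr{L}\,g$ iff $Mf=Mg$; $f\,\mathscr{R}\,g$ iff $fM=gM$; $\mathscr{D}=\mathscr{L}\circ\mathscr{R}$. An element $f$ is regular if $fgf=f$ for some $g\in M$.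
   Formalization: The graph Γ is assumed countable; without this the claim is false, since an uncountable algebraically closed graph (e.g. the complete directed graph on an uncountable set) cannot be an induced subgraph of the countable graph D. *)

theory Defs
  imports
    "HOL-Algebra.Group"
    "HOL-Library.Countable_Set"
    "HOL-Library.Equipollence"
begin

type_synonym 'a digraph = "'a set \<times> 'a rel"

abbreviation verts :: "'a digraph \<Rightarrow> 'a set" where
  "verts \<equiv> fst"

abbreviation edges :: "'a digraph \<Rightarrow> 'a rel" where
  "edges \<equiv> snd"

definition digraph :: "'a digraph \<Rightarrow> bool" where
  "digraph G \<longleftrightarrow> edges G \<subseteq> verts G \<times> verts G \<and> irrefl (edges G)"

definition algebraically_closed :: "'a digraph \<Rightarrow> bool" where
  "algebraically_closed G \<longleftrightarrow>
     (\<forall>A. finite A \<and> A \<subseteq> verts G \<longrightarrow>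
        (\<exists>v\<in>verts G. \<forall>u\<in>A. (u, v) \<in> edges G \<and> (v, u) \<in> edges G))"

definition induced_subgraph :: "'a digraph \<Rightarrow> 'a set \<Rightarrow> 'a digraph" where
  "induced_subgraph G U = (U, edges G \<inter> U \<times> U)"

definition digraph_hom :: "'a digraph \<Rightarrow> 'b digraph \<Rightarrow> ('a \<Rightarrow> 'b) \<Rightarrow> bool" where
  "digraph_hom G H f \<longleftrightarrow>
     f \<in> verts G \<rightarrow> verts H \<and> (\<forall>(u, v)\<in>edges G. (f u, f v) \<in> edges H)"

definition digraph_iso :: "'a digraph \<Rightarrow> 'b digraph \<Rightarrow> ('a \<Rightarrow> 'b) \<Rightarrow> bool" where
  "digraph_iso G H f \<longleftrightarrow>
     bij_betw f (verts G) (verts H) \<and>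
     (\<forall>u\<in>verts G. \<forall>v\<in>verts G. (u, v) \<in> edges G \<longleftrightarrow> (f u, f v) \<in> edges H)"

definition isomorphic :: "'a digraph \<Rightarrow> 'b digraph \<Rightarrow> bool" where
  "isomorphic G H \<longleftrightarrow> (\<exists>f. digraph_iso G H f)"

text \<open>
  The Fraisse limit of the finite directed graphs: the countable homogeneous directed graph
  (every isomorphism between finite induced subgraphs extends to an automorphism) whose age
  consists of all finite directed graphs. This determines the graph up to isomorphism.
  Vertices of the finite graphs are taken in \<^typ>\<open>nat\<close>, which loses nothing up to isomorphism.
\<close>

definition universal_digraph :: "'a digraph \<Rightarrow> bool" where
  "universal_digraph D \<longleftrightarrow>
     digraph D \<and> countable (verts D) \<and>
     (\<forall>G :: nat digraph. digraph G \<and> finite (verts G) \<longrightarrow>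
        (\<exists>U\<subseteq>verts D. isomorphic G (induced_subgraph D U))) \<and>
     (\<forall>A B f. finite A \<and> A \<subseteq> verts D \<and> finite B \<and> B \<subseteq> verts D \<and>
        digraph_iso (induced_subgraph D A) (induced_subgraph D B) f \<longrightarrow>
        (\<exists>g. digraph_iso D D g \<and> (\<forall>x\<in>A. g x = f x)))"

text \<open>
  Maps act on the right: in a product the left factor is applied first. Endomorphisms are
  extensional so that equality of elements is equality of maps on the vertex set.
\<close>

definition End :: "'a digraph \<Rightarrow> ('a \<Rightarrow> 'a) monoid" where
  "End D =
     \<lparr>carrier = {f \<in> extensional (verts D). digraph_hom D D f},
      mult = (\<lambda>f g. compose (verts D) g f),
      one = (\<lambda>x\<in>verts D. x)\<rparr>"

definition green_L :: "('m, 'r) monoid_scheme \<Rightarrow> 'm rel" where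
  "green_L M = {(f, g). f \<in> carrier M \<and> g \<in> carrier M \<and>
     (\<lambda>h. h \<otimes>\<^bsub>M\<^esub> f) ` carrier M = (\<lambda>h. h \<otimes>\<^bsub>M\<^esub> g) ` carrier M}"

definition green_R :: "('m, 'r) monoid_scheme \<Rightarrow> 'm rel" where
  "green_R M = {(f, g). f \<in> carrier M \<and> g \<in> carrier M \<and>
     (\<lambda>h. f \<otimes>\<^bsub>M\<^esub> h) ` carrier M = (\<lambda>h. g \<otimes>\<^bsub>M\<^esub> h) ` carrier M}"

definition green_D :: "('m, 'r) monoid_scheme \<Rightarrow> 'm rel" where
  "green_D M = green_L M O green_R M"

definition regular_element :: "('m, 'r) monoid_scheme \<Rightarrow> 'm \<Rightarrow> bool" where
  "regular_element M f \<longleftrightarrow>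
     f \<in> carrier M \<and> (\<exists>g\<in>carrier M. f \<otimes>\<^bsub>M\<^esub> g \<otimes>\<^bsub>M\<^esub> f = f)"

end

theory Submission imports Defs begin

text \<open>
  Every countable digraph \<open>G\<close> embeds into \<open>D\<close> so that each vertex outside the image has only
  finitely many neighbours in the image. As \<open>D\<close> is algebraically closed, every homomorphism
  \<open>G \<rightarrow> D\<close> then extends along this embedding to an endomorphism of \<open>D\<close>.

  Let \<open>q : D \<rightarrow> \<Gamma>\<close> be a bijective homomorphism, obtained by back-and-forth. Embed as above the
  graph \<open>\<Gamma> \<times> {0,1}\<close> in which every vertex of \<open>\<Gamma>\<close> is doubled into two non-adjacent twins. Each
  choice of one twin per vertex gives an induced copy of \<open>\<Gamma>\<close>; following \<open>q\<close> by these copies yields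
  endomorphisms of \<open>D\<close> that are pairwise \<open>\<R>\<close>-related, but not \<open>\<L>\<close>-related because their images
  differ. If one of them were regular, then \<open>q\<close> would be an isomorphism.
\<close>

section \<open>Embeddings and the one-point extension property of the universal digraph\<close>

definition digraph_embedding :: "'a digraph \<Rightarrow> 'b digraph \<Rightarrow> ('a \<Rightarrow> 'b) \<Rightarrow> bool" where
  "digraph_embedding G H e \<longleftrightarrow>
     e \<in> verts G \<rightarrow> verts H \<and> inj_on e (verts G) \<and>
     (\<forall>u\<in>verts G. \<forall>v\<in>verts G. (u, v) \<in> edges G \<longleftrightarrow> (e u, e v) \<in> edges H)"

text \<open>Directed form of the extension property of the Rado graph: since \<open>I\<close> and
  \<open>J\<close> are independent, all four adjacency patterns can be prescribed at each vertex of
  \<open>A\<close>. Excluding \<open>A\<close> matters, as a vertex of \<open>A\<close> outside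
  \<open>I\<close> and \<open>J\<close> might realise the pattern itself.\<close>

definition extension_property :: "'a digraph \<Rightarrow> bool" where
  "extension_property G \<longleftrightarrow>
     (\<forall>A I J. finite A \<and> A \<subseteq> verts G \<longrightarrow>
        (\<exists>v\<in>verts G - A. \<forall>u\<in>A. ((u, v) \<in> edges G \<longleftrightarrow> u \<in> I) \<and> ((v, u) \<in> edges G \<longleftrightarrow> u \<in> J)))"

lemma extension_propertyE:
  assumes "extension_property G" "finite A" "A \<subseteq> verts G"
  obtains v where "v \<in> verts G - A"
    "\<forall>u\<in>A. ((u, v) \<in> edges G \<longleftrightarrow> u \<in> I) \<and> ((v, u) \<in> edges G \<longleftrightarrow> u \<in> J)"
  using assms(1)[unfolded extension_property_def, THEN spec[of _ A], THEN spec[of _ I], THEN spec[of _ J]]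
    assms(2,3) by (auto elim: bexE)

lemma finite_to_nat_on_less:
  assumes "countable A"
  shows "finite {y \<in> A. to_nat_on A y < n}"
proof (rule finite_imageD)
  show "finite (to_nat_on A ` {y \<in> A. to_nat_on A y < n})"
    by (rule finite_subset[of _ "{..<n}"]) auto
  show "inj_on (to_nat_on A) {y \<in> A. to_nat_on A y < n}"
    by (rule inj_on_subset[OF inj_on_to_nat_on[OF assms]]) auto
qed

lemma digraph_edgeD:
  assumes "digraph G" "(u, v) \<in> edges G"
  shows "u \<in> verts G" "v \<in> verts G" "u \<noteq> v"
  using assms by (auto simp: digraph_def irrefl_def)

lemma digraph_iso_inv_into:
  assumes "digraph_iso G H f"
  shows "digraph_iso H G (inv_into (verts G) f)"
proof -
  have b: "bij_betw f (verts G) (verts H)"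
    and e: "\<And>u v. u \<in> verts G \<Longrightarrow> v \<in> verts G \<Longrightarrow> (u, v) \<in> edges G \<longleftrightarrow> (f u, f v) \<in> edges H"
    using assms by (auto simp: digraph_iso_def)
  have "\<And>y. y \<in> verts H \<Longrightarrow> inv_into (verts G) f y \<in> verts G \<and> f (inv_into (verts G) f y) = y"
    using b by (metis bij_betw_def f_inv_into_f inv_into_into)
  then show ?thesis
    using e b by (simp add: digraph_iso_def bij_betw_inv_into)
qed

lemma isomorphic_sym: "isomorphic G H \<Longrightarrow> isomorphic H G"
  unfolding isomorphic_def by (blast dest: digraph_iso_inv_into)

text \<open>Universality embeds the desired one-point extension of \<open>A\<close> somewhere in
  \<open>D\<close>; homogeneity then carries the embedded copy of \<open>A\<close> back onto
  \<open>A\<close>, and the extra point travels along.\<close>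

lemma universal_digraph_extension_property:
  fixes D :: "'a digraph"
  assumes "universal_digraph D"
  shows "extension_property D"
  unfolding extension_property_def
proof (intro allI impI, elim conjE)
  fix A I J :: "'a set"
  assume A: "finite A" "A \<subseteq> verts D"
  have D: "digraph D" and
    univ: "\<And>G :: nat digraph. digraph G \<and> finite (verts G) \<Longrightarrow>
        \<exists>U\<subseteq>verts D. isomorphic G (induced_subgraph D U)" and
    homog: "\<And>A B f. finite A \<and> A \<subseteq> verts D \<and> finite B \<and> B \<subseteq> verts D \<and>
        digraph_iso (induced_subgraph D A) (induced_subgraph D B) f \<Longrightarrow>
        \<exists>g. digraph_iso D D g \<and> (\<forall>x\<in>A. g x = f x)"
    using assms unfolding universal_digraph_def by blast+
  obtain c :: "'a \<Rightarrow> nat" and n where c: "c ` A = {i. i < n}" "inj_on c A"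
    using finite_imp_inj_to_nat_seg[OF A(1)] by metis
  \<comment> \<open>The code \<open>c\<close> fills exactly the numbers below \<open>n\<close>,
    which leaves \<open>n\<close> free for the new vertex.\<close>
  define G :: "nat digraph" where
    "G = ({i. i \<le> n}, {(c u, c v) |u v. u \<in> A \<and> v \<in> A \<and> (u, v) \<in> edges D} \<union>
        {(c u, n) |u. u \<in> A \<and> u \<in> I} \<union> {(n, c u) |u. u \<in> A \<and> u \<in> J})"
  have cn: "c u < n" if "u \<in> A" for u
    using c that by blast
  have "irrefl (edges G)"
    using cn c(2) digraph_edgeD(3)[OF D]
    by (force simp: irrefl_def G_def dest: inj_onD)
  moreover have "edges G \<subseteq> verts G \<times> verts G"
    using cn by (force simp: G_def)
  ultimately have "digraph G \<and> finite (verts G)"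
    by (simp add: digraph_def G_def)
  then obtain U p where U: "U \<subseteq> verts D" and p: "digraph_iso G (induced_subgraph D U) p"
    using univ unfolding isomorphic_def by metis
  have pbij: "bij_betw p {i. i \<le> n} U"
    and pe: "\<And>i j. i \<le> n \<Longrightarrow> j \<le> n \<Longrightarrow> (i, j) \<in> edges G \<longleftrightarrow> (p i, p j) \<in> edges D \<inter> U \<times> U"
    using p by (auto simp: digraph_iso_def induced_subgraph_def G_def)
  have pU: "p i \<in> U" if "i \<le> n" for i
    using pbij that by (auto simp: bij_betw_def)
  define B where "B = (\<lambda>u. p (c u)) ` A"
  have inj: "inj_on (\<lambda>u. p (c u)) A"
    using pbij c(2) cn unfolding bij_betw_def inj_on_def by (metis mem_Collect_eq less_imp_le)
  have BU: "B \<subseteq> U"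
    using pU cn by (auto simp: B_def less_imp_le)
  have Gc: "(c u, c v) \<in> edges G \<longleftrightarrow> (u, v) \<in> edges D" if "u \<in> A" "v \<in> A" for u v
    using that cn[OF that(1)] cn[OF that(2)] by (auto simp: G_def dest: inj_onD[OF c(2)])
  have GI: "(c u, n) \<in> edges G \<longleftrightarrow> u \<in> I" and GJ: "(n, c u) \<in> edges G \<longleftrightarrow> u \<in> J" if "u \<in> A" for u
    using that cn by (auto simp: G_def dest: inj_onD[OF c(2)])
  have "digraph_iso (induced_subgraph D A) (induced_subgraph D B) (\<lambda>u. p (c u))"
    unfolding digraph_iso_def induced_subgraph_def
    using inj BU pe[OF less_imp_le[OF cn] less_imp_le[OF cn]] Gc
    by (auto simp: bij_betw_def B_def)
  \<comment> \<open>Homogeneity is needed in the direction from the copy \<open>B\<close> to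
    \<open>A\<close>, hence the inverse.\<close>
  then have "digraph_iso (induced_subgraph D B) (induced_subgraph D A) (inv_into A (\<lambda>u. p (c u)))"
    by (metis digraph_iso_inv_into induced_subgraph_def fst_conv)
  then obtain g where g: "digraph_iso D D g" and gB: "\<forall>x\<in>B. g x = inv_into A (\<lambda>u. p (c u)) x"
    using homog[of B A "inv_into A (\<lambda>u. p (c u))"] A U BU finite_imageI[OF A(1)] unfolding B_def by blast
  have gA: "g (p (c u)) = u" if "u \<in> A" for u
    using gB that inv_into_f_f[OF inj that] by (simp add: B_def)
  have gbij: "inj_on g (verts D)" "g ` verts D = verts D"
    and ge: "\<And>u v. u \<in> verts D \<Longrightarrow> v \<in> verts D \<Longrightarrow> (u, v) \<in> edges D \<longleftrightarrow> (g u, g v) \<in> edges D"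
    using g by (auto simp: digraph_iso_def bij_betw_def)
  define v where "v = g (p n)"
  have "v \<in> verts D"
    using gbij(2) pU[of n] U by (auto simp: v_def)
  moreover have "v \<notin> A"
  proof
    assume vA: "v \<in> A"
    then have "g (p (c v)) = g (p n)"
      using gA by (simp add: v_def)
    then have "p (c v) = p n"
      using gbij(1) pU[of n] pU[OF less_imp_le[OF cn[OF vA]]] U by (meson inj_onD subsetD order_refl)
    then have "c v = n"
      using pbij cn[OF vA] by (auto simp: bij_betw_def inj_on_def)
    then show False
      using cn[OF vA] by simp
  qed
  moreover have "((u, v) \<in> edges D \<longleftrightarrow> u \<in> I) \<and> ((v, u) \<in> edges D \<longleftrightarrow> u \<in> J)" if u: "u \<in> A" for u
  proof -
    have le: "c u \<le> n" and PU: "p (c u) \<in> U" "p n \<in> U"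
      using cn[OF u] pU by auto
    have "(u, v) \<in> edges D \<longleftrightarrow> (p (c u), p n) \<in> edges D"
      using ge[of "p (c u)" "p n"] PU U gA[OF u] by (auto simp: v_def)
    moreover have "(v, u) \<in> edges D \<longleftrightarrow> (p n, p (c u)) \<in> edges D"
      using ge[of "p n" "p (c u)"] PU U gA[OF u] by (auto simp: v_def)
    ultimately show ?thesis
      using pe[OF le order_refl] pe[OF order_refl le] GI[OF u] GJ[OF u] PU by auto
  qed
  ultimately show "\<exists>v\<in>verts D - A. \<forall>u\<in>A.
      ((u, v) \<in> edges D \<longleftrightarrow> u \<in> I) \<and> ((v, u) \<in> edges D \<longleftrightarrow> u \<in> J)"
    by blast
qed

lemma extension_property_algebraically_closed:
  assumes "extension_property G"
  shows "algebraically_closed G"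
  unfolding algebraically_closed_def
proof (intro allI impI)
  fix A assume "finite A \<and> A \<subseteq> verts G"
  then obtain v where "v \<in> verts G - A"
    "\<forall>u\<in>A. ((u, v) \<in> edges G \<longleftrightarrow> u \<in> A) \<and> ((v, u) \<in> edges G \<longleftrightarrow> u \<in> A)"
    using extension_propertyE[OF assms, of A A A] by metis
  then show "\<exists>v\<in>verts G. \<forall>u\<in>A. (u, v) \<in> edges G \<and> (v, u) \<in> edges G"
    by blast
qed

text \<open>In a finite graph, a vertex joined to all vertices would carry a loop.\<close>

lemma algebraically_closed_infinite:
  assumes "digraph G" "algebraically_closed G"
  shows "infinite (verts G)"
proof
  assume "finite (verts G)"
  then obtain v where "v \<in> verts G" "(v, v) \<in> edges G"
    using assms(2) unfolding algebraically_closed_def by blast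
  then show False
    using digraph_edgeD(3)[OF assms(1)] by blast
qed

section \<open>Sparse embeddings into \<open>D\<close> and extension of homomorphisms along
  them\<close>

lemma wf_to_nat_on_less: "wf {(y, x). y \<in> A \<and> x \<in> A \<and> to_nat_on A y < to_nat_on A x}"
  by (rule wf_subset[OF wf_measure[of "to_nat_on A"]]) auto

text \<open>
  The vertex chosen for the \<open>n\<close>-th vertex of \<open>G\<close> avoids, and is not adjacent to, the first
  \<open>n\<close> vertices of \<open>D\<close>, except those already in the image; so a vertex outside the final image
  is adjacent to finitely many image vertices only.
\<close>

lemma ex_embedding_finite_adjacency:
  fixes D :: "'a digraph" and G :: "'b digraph"
  assumes "countable (verts D)" "extension_property D" "digraph D"
    and G: "digraph G" "countable (verts G)"
  obtains e where "digraph_embedding G D e"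
    "\<And>d. d \<in> verts D - e ` verts G \<Longrightarrow>
       finite {u \<in> e ` verts G. (u, d) \<in> edges D \<or> (d, u) \<in> edges D}"
proof -
  define i where "i = to_nat_on (verts G)"
  define j where "j = to_nat_on (verts D)"
  define pre where "pre x = {y \<in> verts G. i y < i x}" for x
  \<comment> \<open>\<open>f\<close> records the earlier choices and \<open>r\<close> is the
    candidate value at \<open>x\<close>. The recursion runs over the whole type, so the condition is
    vacuous outside \<open>verts G\<close>.\<close>
  define P where "P f x r \<longleftrightarrow> (x \<in> verts G \<longrightarrow>
      r \<in> verts D \<and>
      (\<forall>y\<in>pre x. r \<noteq> f y \<and> ((f y, r) \<in> edges D \<longleftrightarrow> (y, x) \<in> edges G) \<and>
                     ((r, f y) \<in> edges D \<longleftrightarrow> (x, y) \<in> edges G)) \<and>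
      (\<forall>d\<in>verts D. j d < i x \<longrightarrow> d \<notin> f ` pre x \<longrightarrow> r \<noteq> d \<and> (r, d) \<notin> edges D \<and> (d, r) \<notin> edges D))"
    for f :: "'b \<Rightarrow> 'a" and x r
  let ?R = "{(y, x). y \<in> verts G \<and> x \<in> verts G \<and> i y < i x}"
  have "\<exists>f. \<forall>x. P f x (f x)"
  proof (rule dependent_wf_choice[of ?R])
    show "wf ?R"
      unfolding i_def by (rule wf_to_nat_on_less)
  next
    fix f g :: "'b \<Rightarrow> 'a" and x r
    assume fg: "\<And>z. (z, x) \<in> ?R \<Longrightarrow> f z = g z"
    show "P f x r = P g x r"
    proof (cases "x \<in> verts G")
      case True
      then have "\<forall>y\<in>pre x. f y = g y"
        using fg by (auto simp: pre_def)
      moreover from this have "f ` pre x = g ` pre x"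
        by (auto intro!: image_cong)
      ultimately show ?thesis
        unfolding P_def by auto
    qed (simp add: P_def)
  next
    fix x and f :: "'b \<Rightarrow> 'a"
    assume IH: "\<And>y. (y, x) \<in> ?R \<Longrightarrow> P f y (f y)"
    show "\<exists>r. P f x r"
    proof (cases "x \<in> verts G")
      case True
      have Py: "P f y (f y)" if "y \<in> pre x" for y
        using IH that True by (auto simp: pre_def)
      have finj: "inj_on f (pre x)"
      proof (rule inj_onI)
        fix y z assume yz: "y \<in> pre x" "z \<in> pre x" "f y = f z"
        have "\<not> i y < i z" "\<not> i z < i y"
          using Py[OF yz(1)] Py[OF yz(2)] yz unfolding P_def pre_def by auto
        then have "i y = i z"
          by simp
        then show "y = z"
          using yz G(2) by (auto simp: i_def pre_def)
      qed
      have fin: "finite (f ` pre x \<union> {d \<in> verts D. j d < i x})"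
        using finite_to_nat_on_less[OF G(2)] finite_to_nat_on_less[OF assms(1)]
        by (auto simp: pre_def i_def j_def)
      have sub: "f ` pre x \<union> {d \<in> verts D. j d < i x} \<subseteq> verts D"
        using Py by (auto simp: P_def pre_def)
      \<comment> \<open>Vertices of \<open>D\<close> with index below \<open>i x\<close> that are
        not yet images lie in neither prescribed set, so \<open>v\<close> is not adjacent to
        them.\<close>
      obtain v where v: "v \<in> verts D - (f ` pre x \<union> {d \<in> verts D. j d < i x})"
        "\<forall>u\<in>f ` pre x \<union> {d \<in> verts D. j d < i x}.
           ((u, v) \<in> edges D \<longleftrightarrow> u \<in> f ` {y \<in> pre x. (y, x) \<in> edges G}) \<and>
           ((v, u) \<in> edges D \<longleftrightarrow> u \<in> f ` {y \<in> pre x. (x, y) \<in> edges G})"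
        by (rule extension_propertyE[OF assms(2) fin sub])
      \<comment> \<open>Injectivity on \<open>pre x\<close> lets membership in the prescribed image
        sets be read back as adjacency in \<open>G\<close>.\<close>
      have mem: "f y \<in> f ` {y \<in> pre x. Q y} \<longleftrightarrow> Q y" if "y \<in> pre x" for y Q
        using that inj_onD[OF finj] by blast
      have "v \<noteq> f y \<and> ((f y, v) \<in> edges D \<longleftrightarrow> (y, x) \<in> edges G) \<and>
            ((v, f y) \<in> edges D \<longleftrightarrow> (x, y) \<in> edges G)" if "y \<in> pre x" for y
        using v(1) that bspec[OF v(2), of "f y"] mem[OF that, of "\<lambda>y. (y, x) \<in> edges G"]
          mem[OF that, of "\<lambda>y. (x, y) \<in> edges G"] by auto
      moreover have "v \<noteq> d \<and> (v, d) \<notin> edges D \<and> (d, v) \<notin> edges D"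
        if "d \<in> verts D" "j d < i x" "d \<notin> f ` pre x" for d
        using v(1) that bspec[OF v(2), of d] by auto
      ultimately have "P f x v"
        using v(1) unfolding P_def by blast
      then show ?thesis ..
    qed (simp add: P_def)
  qed
  then obtain e where e: "\<And>x. P e x (e x)"
    by blast
  have eV: "e x \<in> verts D" if "x \<in> verts G" for x
    using e[of x] that by (simp add: P_def)
  have less: "e x \<noteq> e y \<and> ((e y, e x) \<in> edges D \<longleftrightarrow> (y, x) \<in> edges G) \<and>
      ((e x, e y) \<in> edges D \<longleftrightarrow> (x, y) \<in> edges G)"
    if "x \<in> verts G" "y \<in> verts G" "i y < i x" for x y
    using e[of x] that by (simp add: P_def pre_def)
  have idx: "x = y \<or> i y < i x \<or> i x < i y" if "x \<in> verts G" "y \<in> verts G" for x y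
    using that G(2) by (metis i_def linorder_neqE_nat to_nat_on_inj)
  have "digraph_embedding G D e"
    unfolding digraph_embedding_def
  proof (intro conjI ballI)
    show "e \<in> verts G \<rightarrow> verts D"
      using eV by blast
    show "inj_on e (verts G)"
      using idx less by (metis inj_onI)
    fix u v assume uv: "u \<in> verts G" "v \<in> verts G"
    show "(u, v) \<in> edges G \<longleftrightarrow> (e u, e v) \<in> edges D"
      using idx[OF uv] less[OF uv] less[OF uv(2,1)] digraph_edgeD(3)[OF G(1)] digraph_edgeD(3)[OF assms(3)]
      by metis
  qed
  moreover have "finite {u \<in> e ` verts G. (u, d) \<in> edges D \<or> (d, u) \<in> edges D}"
    if d: "d \<in> verts D - e ` verts G" for d
  proof (rule finite_subset)
    show "finite (e ` {x \<in> verts G. i x < Suc (j d)})"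
      unfolding i_def using finite_to_nat_on_less[OF G(2)] by blast
    \<comment> \<open>If \<open>j d < i x\<close>, the choice of \<open>e x\<close> already avoided
      adjacency to \<open>d\<close>; so neighbours of \<open>d\<close> come from indices at most
      \<open>j d\<close>.\<close>
    show "{u \<in> e ` verts G. (u, d) \<in> edges D \<or> (d, u) \<in> edges D} \<subseteq> e ` {x \<in> verts G. i x < Suc (j d)}"
    proof clarify
      fix x assume x: "x \<in> verts G" "(e x, d) \<in> edges D \<or> (d, e x) \<in> edges D"
      have "\<not> j d < i x"
        using e[of x] x d by (auto simp: P_def pre_def)
      then show "e x \<in> e ` {x \<in> verts G. i x < Suc (j d)}"
        using x(1) by auto
    qed
  qed
  ultimately show ?thesis
    using that by blast
qed

text \<open>Vertices outside \<open>U\<close> are treated one at a time. Each has finitely many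
  neighbours in \<open>U\<close> and finitely many predecessors outside it, so algebraic closure of
  \<open>H\<close> provides a value.\<close>

lemma hom_extends_if_finite_adjacency:
  fixes G :: "'a digraph" and H :: "'b digraph"
  assumes G: "digraph G" "countable (verts G)" and "algebraically_closed H" and U: "U \<subseteq> verts G"
    and fin: "\<And>d. d \<in> verts G - U \<Longrightarrow> finite {u \<in> U. (u, d) \<in> edges G \<or> (d, u) \<in> edges G}"
    and p: "digraph_hom (induced_subgraph G U) H p"
  obtains h where "digraph_hom G H h" "\<And>u. u \<in> U \<Longrightarrow> h u = p u"
proof -
  define j where "j = to_nat_on (verts G - U)"
  define N where "N x = {u \<in> U. (u, x) \<in> edges G \<or> (x, u) \<in> edges G}" for x
  define pre where "pre x = {y \<in> verts G - U. j y < j x}" for x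
  \<comment> \<open>The value is joined both ways to all earlier new values, adjacent or not: a
    homomorphism may create edges.\<close>
  define P where "P f x r \<longleftrightarrow> (x \<in> verts G - U \<longrightarrow>
      r \<in> verts H \<and> (\<forall>w \<in> p ` N x \<union> f ` pre x. (w, r) \<in> edges H \<and> (r, w) \<in> edges H))"
    for f :: "'a \<Rightarrow> 'b" and x r
  have pH: "\<And>u. u \<in> U \<Longrightarrow> p u \<in> verts H"
    and pe: "\<And>u v. u \<in> U \<Longrightarrow> v \<in> U \<Longrightarrow> (u, v) \<in> edges G \<Longrightarrow> (p u, p v) \<in> edges H"
    using p by (auto simp: digraph_hom_def induced_subgraph_def)
  have cnt: "countable (verts G - U)"
    using G(2) by blast
  let ?R = "{(y, x). y \<in> verts G - U \<and> x \<in> verts G - U \<and> j y < j x}"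
  have "\<exists>f. \<forall>x. P f x (f x)"
  proof (rule dependent_wf_choice[of ?R])
    show "wf ?R"
      unfolding j_def by (rule wf_to_nat_on_less)
  next
    fix f g :: "'a \<Rightarrow> 'b" and x r
    assume fg: "\<And>z. (z, x) \<in> ?R \<Longrightarrow> f z = g z"
    show "P f x r = P g x r"
    proof (cases "x \<in> verts G - U")
      case True
      then have "f ` pre x = g ` pre x"
        using fg by (intro image_cong) (auto simp: pre_def)
      then show ?thesis
        by (simp add: P_def)
    qed (simp only: P_def simp_thms)
  next
    fix x and f :: "'a \<Rightarrow> 'b"
    assume IH: "\<And>y. (y, x) \<in> ?R \<Longrightarrow> P f y (f y)"
    show "\<exists>r. P f x r"
    proof (cases "x \<in> verts G - U")
      case True
      have "f y \<in> verts H" if "y \<in> pre x" for y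
        using IH[of y] that True unfolding P_def pre_def by blast
      then have "p ` N x \<union> f ` pre x \<subseteq> verts H"
        using pH by (auto simp: N_def)
      moreover have "finite (p ` N x \<union> f ` pre x)"
        using fin[OF True] finite_to_nat_on_less[OF cnt] by (auto simp: pre_def N_def j_def)
      ultimately obtain r where "r \<in> verts H" "\<forall>w \<in> p ` N x \<union> f ` pre x. (w, r) \<in> edges H \<and> (r, w) \<in> edges H"
        using assms(3)[unfolded algebraically_closed_def, THEN spec[of _ "p ` N x \<union> f ` pre x"]] by blast
      then have "P f x r"
        unfolding P_def by blast
      then show ?thesis ..
    qed (simp only: P_def simp_thms)
  qed
  then obtain f where f: "\<And>x. P f x (f x)"
    by blast
  define h where "h x = (if x \<in> U then p x else f x)" for x
  have "(h u, h v) \<in> edges H" if uv: "(u, v) \<in> edges G" for u v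
  proof -
    have V: "u \<in> verts G" "v \<in> verts G" "u \<noteq> v"
      using digraph_edgeD[OF G(1) uv] .
    consider "u \<in> U" "v \<in> U" | "u \<in> U" "v \<notin> U" | "u \<notin> U" "v \<in> U" | "u \<notin> U" "v \<notin> U"
      by blast
    then show ?thesis
    proof cases
      case 1
      then show ?thesis
        using pe uv by (simp add: h_def)
    next
      case 2
      then show ?thesis
        using f[of v] V uv by (auto simp: h_def P_def N_def)
    next
      case 3
      then show ?thesis
        using f[of u] V uv by (auto simp: h_def P_def N_def)
    next
      case 4
      then have "j u \<noteq> j v"
        using V cnt by (simp add: j_def)
      then have "u \<in> pre v \<or> v \<in> pre u"
        using 4 V by (auto simp: pre_def)
      then show ?thesis
        using f[of u] f[of v] V 4 by (auto simp: h_def P_def)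
    qed
  qed
  moreover have "h x \<in> verts H" if "x \<in> verts G" for x
    using f[of x] pH that by (auto simp: h_def P_def)
  ultimately have "digraph_hom G H h"
    by (auto simp: digraph_hom_def)
  then show ?thesis
    using that by (simp add: h_def)
qed

text \<open>One embedding \<open>e\<close> serves all \<open>p\<close> at once, because the
  finiteness condition concerns only the image of \<open>e\<close>.\<close>

lemma ex_embedding_extending_homs:
  fixes D :: "'a digraph" and G :: "'b digraph"
  assumes D: "digraph D" "countable (verts D)" "extension_property D"
    and G: "digraph G" "countable (verts G)"
  obtains e where "digraph_embedding G D e"
    "\<And>p. digraph_hom G D p \<Longrightarrow> \<exists>h. digraph_hom D D h \<and> (\<forall>x\<in>verts G. h (e x) = p x)"
proof -
  obtain e where e: "digraph_embedding G D e"
    and fin: "\<And>d. d \<in> verts D - e ` verts G \<Longrightarrow>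
       finite {u \<in> e ` verts G. (u, d) \<in> edges D \<or> (d, u) \<in> edges D}"
    using ex_embedding_finite_adjacency[OF D(2,3,1) G] by blast
  have eU: "e ` verts G \<subseteq> verts D" and inj: "inj_on e (verts G)"
    and ee: "\<And>u v. u \<in> verts G \<Longrightarrow> v \<in> verts G \<Longrightarrow> (e u, e v) \<in> edges D \<Longrightarrow> (u, v) \<in> edges G"
    using e by (auto simp: digraph_embedding_def)
  have "\<exists>h. digraph_hom D D h \<and> (\<forall>x\<in>verts G. h (e x) = p x)" if p: "digraph_hom G D p" for p
  proof -
    let ?p = "\<lambda>u. p (inv_into (verts G) e u)"
    have "digraph_hom (induced_subgraph D (e ` verts G)) D ?p"
      using p ee inj by (fastforce simp: digraph_hom_def induced_subgraph_def)
    then obtain h where "digraph_hom D D h" "\<And>u. u \<in> e ` verts G \<Longrightarrow> h u = ?p u"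
      using hom_extends_if_finite_adjacency[OF D(1,2) extension_property_algebraically_closed[OF D(3)] eU fin]
      by blast
    then show ?thesis
      using inj by (intro exI[of _ h]) simp
  qed
  then show ?thesis
    using that e by blast
qed


section \<open>A bijective homomorphism by back-and-forth\<close>

text \<open>Going forth, algebraic closure of \<open>H\<close> gives a value joined both ways to all
  earlier values. Going back, the extension property of \<open>D\<close> gives a preimage with no
  edges to earlier vertices, so nothing has to be preserved.\<close>

lemma ex_bijective_hom:
  fixes D :: "'a digraph" and H :: "'b digraph"
  assumes D: "digraph D" "countable (verts D)" "extension_property D"
    and H: "digraph H" "countable (verts H)" "algebraically_closed H"
  obtains q where "digraph_hom D H q" "bij_betw q (verts D) (verts H)"
proof -
  \<comment> \<open>Finite partial maps as relations: the equivalence makes them single-valued and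
    injective, while edges are preserved in one direction only.\<close>
  define ok where "ok P \<longleftrightarrow> finite P \<and> P \<subseteq> verts D \<times> verts H \<and>
      (\<forall>x y x' y'. (x, y) \<in> P \<longrightarrow> (x', y') \<in> P \<longrightarrow>
         (x = x' \<longleftrightarrow> y = y') \<and> ((x, x') \<in> edges D \<longrightarrow> (y, y') \<in> edges H))" for P :: "('a \<times> 'b) set"
  have okD: "finite P" "P \<subseteq> verts D \<times> verts H"
    "\<And>x y x' y'. (x, y) \<in> P \<Longrightarrow> (x', y') \<in> P \<Longrightarrow>
       (x = x' \<longleftrightarrow> y = y') \<and> ((x, x') \<in> edges D \<longrightarrow> (y, y') \<in> edges H)" if "ok P" for P
    using that unfolding ok_def by blast+
  have forth_step: "\<exists>P'. ok P' \<and> P \<subseteq> P' \<and> x \<in> Domain P'" if P: "ok P" and x: "x \<in> verts D" for P x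
  proof (cases "x \<in> Domain P")
    case False
    have "finite (Range P) \<and> Range P \<subseteq> verts H"
      using okD(1,2)[OF P] by (auto simp: finite_Range)
    then obtain y where y: "y \<in> verts H" "\<forall>u\<in>Range P. (u, y) \<in> edges H \<and> (y, u) \<in> edges H"
      using H(3) unfolding algebraically_closed_def by blast
    \<comment> \<open>Otherwise \<open>y\<close> would be joined to itself.\<close>
    then have "y \<notin> Range P"
      using digraph_edgeD(3)[OF H(1)] by blast
    then have "ok (insert (x, y) P)"
      using okD[OF P] y x False digraph_edgeD(3)[OF D(1)] unfolding ok_def by blast
    then show ?thesis
      by blast
  qed (use P in blast)
  have back_step: "\<exists>P'. ok P' \<and> P \<subseteq> P' \<and> y \<in> Range P'" if P: "ok P" and y: "y \<in> verts H" for P y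
  proof (cases "y \<in> Range P")
    case False
    have "finite (Domain P)" "Domain P \<subseteq> verts D"
      using okD(1,2)[OF P] by (auto simp: finite_Domain)
    then obtain x where x: "x \<in> verts D - Domain P"
      "\<forall>u\<in>Domain P. ((u, x) \<in> edges D \<longleftrightarrow> u \<in> {}) \<and> ((x, u) \<in> edges D \<longleftrightarrow> u \<in> {})"
      by (rule extension_propertyE[OF D(3)])
    then have "ok (insert (x, y) P)"
      using okD[OF P] y False digraph_edgeD(3)[OF D(1)] unfolding ok_def by blast
    then show ?thesis
      by blast
  qed (use P in blast)
  \<comment> \<open>Nonemptiness ensures that \<open>from_nat_into\<close> yields only
    vertices.\<close>
  have ne: "verts D \<noteq> {}" "verts H \<noteq> {}"
    using algebraically_closed_infinite[OF D(1) extension_property_algebraically_closed[OF D(3)]]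
      algebraically_closed_infinite[OF H(1,3)] by auto
  have "\<exists>P. \<forall>n. ok (P n) \<and> (P n \<subseteq> P (Suc n) \<and> from_nat_into (verts D) n \<in> Domain (P (Suc n)) \<and>
      from_nat_into (verts H) n \<in> Range (P (Suc n)))"
  proof (rule dependent_nat_choice)
    show "\<exists>P. ok P"
      by (rule exI[of _ "{}"]) (simp add: ok_def)
    fix P n assume "ok P"
    then obtain P1 where P1: "ok P1" "P \<subseteq> P1" "from_nat_into (verts D) n \<in> Domain P1"
      using forth_step from_nat_into[OF ne(1)] by meson
    then obtain P2 where P2: "ok P2" "P1 \<subseteq> P2" "from_nat_into (verts H) n \<in> Range P2"
      using back_step from_nat_into[OF ne(2)] by meson
    show "\<exists>P'. ok P' \<and> (P \<subseteq> P' \<and> from_nat_into (verts D) n \<in> Domain P' \<and>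
        from_nat_into (verts H) n \<in> Range P')"
      using P1 P2 by blast
  qed
  then obtain P where P: "\<And>n. ok (P n)" "\<And>n. P n \<subseteq> P (Suc n)"
    "\<And>n. from_nat_into (verts D) n \<in> Domain (P (Suc n))"
    "\<And>n. from_nat_into (verts H) n \<in> Range (P (Suc n))"
    by blast
  define T where "T = (\<Union>n. P n)"
  have mono: "P m \<subseteq> P n" if "m \<le> n" for m n
    by (rule lift_Suc_mono_le[of P, OF P(2) that])
  have T: "(x = x' \<longleftrightarrow> y = y') \<and> ((x, x') \<in> edges D \<longrightarrow> (y, y') \<in> edges H)"
    if xy: "(x, y) \<in> T" "(x', y') \<in> T" for x y x' y'
  proof -
    \<comment> \<open>The two pairs may enter at different stages; both are present at the later
      one.\<close>
    obtain m n where "(x, y) \<in> P m" "(x', y') \<in> P n"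
      using xy by (auto simp: T_def)
    then have "(x, y) \<in> P (max m n)" "(x', y') \<in> P (max m n)"
      using mono[of m "max m n"] mono[of n "max m n"] by auto
    then show ?thesis
      using okD(3)[OF P(1)] by blast
  qed
  have TV: "T \<subseteq> verts D \<times> verts H"
    using okD(2)[OF P(1)] by (auto simp: T_def)
  have dom: "\<exists>y. (x, y) \<in> T" if "x \<in> verts D" for x
    using P(3)[of "to_nat_on (verts D) x"] that D(2) by (auto simp: T_def)
  have ran: "\<exists>x. (x, y) \<in> T" if "y \<in> verts H" for y
    using P(4)[of "to_nat_on (verts H) y"] that H(2) by (auto simp: T_def)
  define q where "q x = (SOME y. (x, y) \<in> T)" for x
  have q: "(x, q x) \<in> T" if "x \<in> verts D" for x
    unfolding q_def using someI_ex[OF dom[OF that]] .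
  have "digraph_hom D H q"
    unfolding digraph_hom_def
  proof (intro conjI)
    show "q \<in> verts D \<rightarrow> verts H"
      using q TV by blast
    show "\<forall>(u, v)\<in>edges D. (q u, q v) \<in> edges H"
      using T[OF q q] digraph_edgeD[OF D(1)] by blast
  qed
  moreover have "inj_on q (verts D)"
    using T[OF q q] by (auto simp: inj_on_def)
  moreover have "q ` verts D = verts H"
  proof (intro equalityI subsetI)
    fix y assume "y \<in> verts H"
    then obtain x where x: "(x, y) \<in> T"
      using ran by blast
    then have "x \<in> verts D" "q x = y"
      using TV T[OF q x] by auto
    then show "y \<in> q ` verts D"
      by blast
  qed (use q TV in blast)
  ultimately show ?thesis
    using that by (simp add: bij_betw_def)
qed

section \<open>The endomorphism monoid and Green's relations\<close>

lemma End_carrier_iff: "f \<in> carrier (End D) \<longleftrightarrow> f \<in> extensional (verts D) \<and> digraph_hom D D f"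
  by (simp add: End_def)

lemma End_mult: "f \<otimes>\<^bsub>End D\<^esub> g = (\<lambda>x\<in>verts D. g (f x))"
  by (simp add: End_def compose_def)

text \<open>Maps constructed without regard to extensionality enter \<open>End D\<close> by
  restriction, which is harmless because edges have both ends in \<open>verts D\<close>.\<close>

lemma restrict_End_iff:
  assumes "digraph D"
  shows "restrict f (verts D) \<in> carrier (End D) \<longleftrightarrow> digraph_hom D D f"
proof -
  have "(\<forall>(u, v)\<in>edges D. (restrict f (verts D) u, restrict f (verts D) v) \<in> edges D) \<longleftrightarrow>
      (\<forall>(u, v)\<in>edges D. (f u, f v) \<in> edges D)"
    using digraph_edgeD[OF assms] by (intro ball_cong) auto
  then show ?thesis
    by (simp add: End_carrier_iff digraph_hom_def Pi_iff)
qed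

lemma End_apply_closed: "f \<in> carrier (End D) \<Longrightarrow> x \<in> verts D \<Longrightarrow> f x \<in> verts D"
  by (auto simp: End_carrier_iff digraph_hom_def)

lemma End_eqI:
  assumes "f \<in> carrier (End D)" "g \<in> carrier (End D)" "\<And>x. x \<in> verts D \<Longrightarrow> f x = g x"
  shows "f = g"
  using assms by (auto simp: End_carrier_iff intro: extensionalityI)

lemma monoid_End:
  assumes "digraph D"
  shows "monoid (End D)"
proof
  show mult: "f \<otimes>\<^bsub>End D\<^esub> g \<in> carrier (End D)"
    if "f \<in> carrier (End D)" "g \<in> carrier (End D)" for f g
    using that unfolding End_mult restrict_End_iff[OF assms]
    by (auto simp: End_carrier_iff digraph_hom_def)
  show one: "\<one>\<^bsub>End D\<^esub> \<in> carrier (End D)"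
    using restrict_End_iff[OF assms, of "\<lambda>x. x"] by (simp add: End_def digraph_hom_def)
  show "f \<otimes>\<^bsub>End D\<^esub> g \<otimes>\<^bsub>End D\<^esub> h = f \<otimes>\<^bsub>End D\<^esub> (g \<otimes>\<^bsub>End D\<^esub> h)"
    if "f \<in> carrier (End D)" "g \<in> carrier (End D)" "h \<in> carrier (End D)" for f g h
    using End_apply_closed[OF that(1)] by (auto simp: End_mult)
  show "\<one>\<^bsub>End D\<^esub> \<otimes>\<^bsub>End D\<^esub> f = f" "f \<otimes>\<^bsub>End D\<^esub> \<one>\<^bsub>End D\<^esub> = f" if f: "f \<in> carrier (End D)" for f
    using mult[OF one f] mult[OF f one] f End_apply_closed[OF f]
    by (auto intro!: End_eqI[where D = D] simp: End_mult) (auto simp: End_def)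
qed

context monoid
begin

text \<open>With an identity, inclusion of principal left ideals is divisibility. In
  \<open>End D\<close> the left factor acts first, so related maps have equal images.\<close>

lemma green_L_iff:
  "(a, b) \<in> green_L G \<longleftrightarrow> a \<in> carrier G \<and> b \<in> carrier G \<and>
     (\<exists>u\<in>carrier G. a = u \<otimes> b) \<and> (\<exists>v\<in>carrier G. b = v \<otimes> a)"
proof -
  have sub: "(\<lambda>h. h \<otimes> a) ` carrier G \<subseteq> (\<lambda>h. h \<otimes> b) ` carrier G \<longleftrightarrow> (\<exists>u\<in>carrier G. a = u \<otimes> b)"
    if ab: "a \<in> carrier G" "b \<in> carrier G" for a b
  proof
    assume "(\<lambda>h. h \<otimes> a) ` carrier G \<subseteq> (\<lambda>h. h \<otimes> b) ` carrier G"
    moreover have "a \<in> (\<lambda>h. h \<otimes> a) ` carrier G"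
      using ab by (intro image_eqI[of _ _ \<one>]) auto
    ultimately show "\<exists>u\<in>carrier G. a = u \<otimes> b"
      by blast
  next
    assume "\<exists>u\<in>carrier G. a = u \<otimes> b"
    then obtain u where "u \<in> carrier G" "a = u \<otimes> b"
      by blast
    then show "(\<lambda>h. h \<otimes> a) ` carrier G \<subseteq> (\<lambda>h. h \<otimes> b) ` carrier G"
      using ab by (auto simp: m_assoc[symmetric])
  qed
  show ?thesis
    unfolding green_L_def using sub[of a b] sub[of b a] by blast
qed

text \<open>The dual; in \<open>End D\<close> each of two related maps is the other followed by an
  endomorphism.\<close>

lemma green_R_iff:
  "(a, b) \<in> green_R G \<longleftrightarrow> a \<in> carrier G \<and> b \<in> carrier G \<and>
     (\<exists>u\<in>carrier G. a = b \<otimes> u) \<and> (\<exists>v\<in>carrier G. b = a \<otimes> v)"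
proof -
  have sub: "(\<lambda>h. a \<otimes> h) ` carrier G \<subseteq> (\<lambda>h. b \<otimes> h) ` carrier G \<longleftrightarrow> (\<exists>u\<in>carrier G. a = b \<otimes> u)"
    if ab: "a \<in> carrier G" "b \<in> carrier G" for a b
  proof
    assume "(\<lambda>h. a \<otimes> h) ` carrier G \<subseteq> (\<lambda>h. b \<otimes> h) ` carrier G"
    moreover have "a \<in> (\<lambda>h. a \<otimes> h) ` carrier G"
      using ab by (intro image_eqI[of _ _ \<one>]) auto
    ultimately show "\<exists>u\<in>carrier G. a = b \<otimes> u"
      by blast
  next
    assume "\<exists>u\<in>carrier G. a = b \<otimes> u"
    then obtain u where "u \<in> carrier G" "a = b \<otimes> u"
      by blast
    then show "(\<lambda>h. a \<otimes> h) ` carrier G \<subseteq> (\<lambda>h. b \<otimes> h) ` carrier G"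
      using ab by (auto simp: m_assoc)
  qed
  show ?thesis
    unfolding green_R_def using sub[of a b] sub[of b a] by blast
qed

text \<open>\<open>green_D\<close> composes the relations in the opposite order, so this is the
  commutation of Green's relations. If \<open>a = b \<otimes> u\<close>, the missing corner of the
  egg-box is \<open>c \<otimes> u\<close>.\<close>

lemma green_R_L_imp_green_D:
  assumes "(a, b) \<in> green_R G" "(b, c) \<in> green_L G"
  shows "(a, c) \<in> green_D G"
proof -
  obtain u v where uv: "u \<in> carrier G" "v \<in> carrier G" "a = b \<otimes> u" "b = a \<otimes> v"
    and C: "a \<in> carrier G" "b \<in> carrier G"
    using assms(1) unfolding green_R_iff by blast
  obtain w z where wz: "w \<in> carrier G" "z \<in> carrier G" "b = w \<otimes> c" "c = z \<otimes> b" and c: "c \<in> carrier G"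
    using assms(2) unfolding green_L_iff by blast
  have "c \<otimes> u = z \<otimes> a"
    using uv wz C by (metis m_assoc)
  moreover have "a = w \<otimes> (c \<otimes> u)"
    using uv wz C c by (metis m_assoc)
  moreover have "c = c \<otimes> u \<otimes> v"
    using uv wz C c by (metis m_assoc)
  ultimately have "(a, c \<otimes> u) \<in> green_L G" "(c \<otimes> u, c) \<in> green_R G"
    unfolding green_L_iff green_R_iff using C c uv wz by (metis m_closed)+
  then show ?thesis
    unfolding green_D_def by blast
qed

end

section \<open>Counting Green classes\<close>

text \<open>An endomorphism is determined by its graph, coded as a set of natural numbers.\<close>

lemma End_lepoll_continuum:
  fixes D :: "'a digraph"
  assumes "countable (verts D)"
  shows "carrier (End D) \<lesssim> (UNIV :: nat set set)"
proof -
  let ?t = "to_nat_on (verts D)"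
  let ?F = "\<lambda>f. (\<lambda>x. prod_encode (?t x, ?t (f x))) ` verts D"
  have "inj_on ?F (carrier (End D))"
  proof (rule inj_onI)
    fix f g assume f: "f \<in> carrier (End D)" and g: "g \<in> carrier (End D)" and eq: "?F f = ?F g"
    show "f = g"
    proof (rule End_eqI[OF f g])
      fix x assume x: "x \<in> verts D"
      then have "prod_encode (?t x, ?t (f x)) \<in> ?F g"
        using eq by blast
      then obtain y where y: "y \<in> verts D" "?t x = ?t y" "?t (f x) = ?t (g y)"
        by auto
      then show "f x = g x"
        using assms x End_apply_closed[OF f x] End_apply_closed[OF g x] by simp
    qed
  qed
  then show ?thesis
    unfolding lepoll_def by blast
qed

text \<open>Used for both relations: \<open>F\<close> supplies continuum many pairwise unrelated
  elements, and Cantor-Bernstein does the rest.\<close>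

lemma classes_eqpoll_continuum:
  fixes F :: "nat set \<Rightarrow> 'm"
  assumes A: "A \<lesssim> (UNIV :: nat set set)"
    and F: "\<And>S. F S \<in> A" "\<And>S. (F S, F S) \<in> r" "\<And>S. r `` {F S} \<subseteq> B"
    and inj: "\<And>S T. (F S, F T) \<in> r \<Longrightarrow> S = T"
  shows "{C \<in> A // r. C \<subseteq> B} \<approx> (UNIV :: nat set set)"
proof (rule lepoll_antisym)
  have "A // r = (\<lambda>x. r `` {x}) ` A"
    by (auto simp: quotient_def)
  then have "A // r \<lesssim> A"
    by (simp add: image_lepoll)
  moreover have "{C \<in> A // r. C \<subseteq> B} \<lesssim> A // r"
    by (rule subset_imp_lepoll) blast
  ultimately show "{C \<in> A // r. C \<subseteq> B} \<lesssim> (UNIV :: nat set set)"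
    using A by (meson lepoll_trans)
  have "inj (\<lambda>S. r `` {F S})"
    using F(2) inj by (intro injI) blast
  moreover have "range (\<lambda>S. r `` {F S}) \<subseteq> {C \<in> A // r. C \<subseteq> B}"
    using F(1,3) by (auto intro: quotientI)
  ultimately show "(UNIV :: nat set set) \<lesssim> {C \<in> A // r. C \<subseteq> B}"
    unfolding lepoll_def by blast
qed

text \<open>
  Precomposing \<open>f\<close> with split surjections of \<open>D\<close> onto \<open>D\<close> stays in the \<open>\<L>\<close>-class of \<open>f\<close>,
  and \<open>\<R>\<close>-related maps have the same kernel. The split surjections extend retractions onto \<open>D\<close>
  of the disjoint union of \<open>D\<close> with infinitely many isolated vertices.
\<close>

lemma R_classes_of_injective_endomorphism:
  fixes D :: "'a digraph"
  assumes D: "digraph D" "countable (verts D)" "extension_property D"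
    and f: "f \<in> carrier (End D)" "inj_on f (verts D)"
  shows "{C \<in> carrier (End D) // green_R (End D). C \<subseteq> green_D (End D) `` {f}} \<approx> (UNIV :: nat set set)"
proof -
  interpret monoid "End D"
    by (rule monoid_End[OF D(1)])
  have ac: "algebraically_closed D"
    by (rule extension_property_algebraically_closed[OF D(3)])
  obtain a where a: "a \<in> verts D"
    using ac unfolding algebraically_closed_def by blast
  \<comment> \<open>Two distinct values are wanted; an edge provides them by irreflexivity.\<close>
  obtain b where b: "b \<in> verts D" "(a, b) \<in> edges D"
    using ac a unfolding algebraically_closed_def by (metis empty_subsetI finite.simps insert_subset singletonI)
  have ab: "a \<noteq> b"
    using digraph_edgeD(3)[OF D(1) b(2)] .
  define G :: "('a + nat) digraph" where
    "G = (Inl ` verts D \<union> range Inr, (\<lambda>(x, y). (Inl x, Inl y)) ` edges D)"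
  have G: "digraph G" "countable (verts G)"
    using D(1,2) by (auto simp: digraph_def G_def irrefl_def)
  obtain e where e: "digraph_embedding G D e"
    and ext: "\<And>p. digraph_hom G D p \<Longrightarrow> \<exists>h. digraph_hom D D h \<and> (\<forall>x\<in>verts G. h (e x) = p x)"
    using ex_embedding_extending_homs[OF D G] by blast
  have eV: "e (Inr n) \<in> verts D" "x \<in> verts D \<Longrightarrow> e (Inl x) \<in> verts D" for n x
    using e by (auto simp: digraph_embedding_def G_def)
  have "\<exists>h. digraph_hom D D h \<and> (\<forall>x\<in>verts D. h (e (Inl x)) = x) \<and>
      (\<forall>n. h (e (Inr n)) = (if n \<in> S then a else b))" for S
  proof -
    \<comment> \<open>Isolated vertices may go anywhere, so the choice between \<open>a\<close> and
      \<open>b\<close> can encode \<open>S\<close>.\<close>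
    have "digraph_hom G D (case_sum (\<lambda>x. x) (\<lambda>n. if n \<in> S then a else b))"
      using a b by (auto simp: digraph_hom_def G_def)
    then show ?thesis
      using ext by (fastforce simp: G_def)
  qed
  then obtain h where h: "\<And>S. digraph_hom D D (h S)" "\<And>S x. x \<in> verts D \<Longrightarrow> h S (e (Inl x)) = x"
    "\<And>S n. h S (e (Inr n)) = (if n \<in> S then a else b)"
    by metis
  have hV: "h S x \<in> verts D" if "x \<in> verts D" for S x
    using h(1)[of S] that by (auto simp: digraph_hom_def)
  define s where "s = (\<lambda>x\<in>verts D. e (Inl x))"
  have s: "s \<in> carrier (End D)"
    unfolding s_def restrict_End_iff[OF D(1)]
    using e digraph_edgeD[OF D(1)] by (fastforce simp: digraph_hom_def digraph_embedding_def G_def)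
  define g where "g S = restrict (h S) (verts D) \<otimes>\<^bsub>End D\<^esub> f" for S
  have hS: "restrict (h S) (verts D) \<in> carrier (End D)" for S
    using h(1) restrict_End_iff[OF D(1)] by blast
  have g: "g S \<in> carrier (End D)" for S
    unfolding g_def using hS f(1) by blast
  have gx: "g S x = f (h S x)" if "x \<in> verts D" for S x
    using that by (simp add: g_def End_mult)
  \<comment> \<open>\<open>s\<close> is a section of \<open>h S\<close>, so multiplying by it on the
    left recovers \<open>f\<close>.\<close>
  have "f = s \<otimes>\<^bsub>End D\<^esub> g S" for S
    by (rule End_eqI[OF f(1) m_closed[OF s g]]) (simp add: End_mult gx eV h s_def)
  then have L: "(f, g S) \<in> green_L (End D)" for S
    unfolding green_L_iff using f(1) g s hS g_def by blast
  \<comment> \<open>For \<open>n \<in> S\<close>, the map \<open>g S\<close> identifies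
    \<open>e (Inr n)\<close> with \<open>e (Inl a)\<close>. The kernel passes to \<open>g T\<close>,
    and injectivity of \<open>f\<close> then forces \<open>n \<in> T\<close>.\<close>
  have sub: "S \<subseteq> T" if ST: "(g S, g T) \<in> green_R (End D)" for S T
  proof
    fix n assume n: "n \<in> S"
    obtain u where u: "g T = g S \<otimes>\<^bsub>End D\<^esub> u"
      using ST unfolding green_R_iff by blast
    have "g S (e (Inr n)) = g S (e (Inl a))"
      using n a eV h by (simp add: gx)
    then have "g T (e (Inr n)) = g T (e (Inl a))"
      using u a eV by (simp add: End_mult)
    then have "f (h T (e (Inr n))) = f a"
      using a eV h(2) by (simp add: gx)
    then have "h T (e (Inr n)) = a"
      using f(2) a hV[OF eV(1)] by (meson inj_onD)
    then show "n \<in> T"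
      using h(3)[of T n] ab by (auto split: if_splits)
  qed
  show ?thesis
  proof (rule classes_eqpoll_continuum[where F = g])
    show "carrier (End D) \<lesssim> (UNIV :: nat set set)"
      by (rule End_lepoll_continuum[OF D(2)])
    show "(g S, g S) \<in> green_R (End D)" for S
      using g by (simp add: green_R_def)
    show "green_R (End D) `` {g S} \<subseteq> green_D (End D) `` {f}" for S
      using L unfolding green_D_def by blast
    show "S = T" if "(g S, g T) \<in> green_R (End D)" for S T
      using sub that by (metis green_R_iff subset_antisym)
  qed (rule g)
qed

section \<open>Choices of twins over a bijective homomorphism\<close>

theorem theorem4p7:
  fixes D :: "'a digraph" and \<Gamma> :: "'b digraph"
  assumes "universal_digraph D"
    and "digraph \<Gamma>" and "countable (verts \<Gamma>)"
    and "algebraically_closed \<Gamma>"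
    and "\<not> isomorphic \<Gamma> D"
  shows "\<exists>f\<in>carrier (End D).
    \<not> regular_element (End D) f \<and>
    inj_on f (verts D) \<and>
    isomorphic (induced_subgraph D (f ` verts D)) \<Gamma> \<and>
    {C \<in> carrier (End D) // green_R (End D). C \<subseteq> green_D (End D) `` {f}} \<approx> (UNIV :: nat set set) \<and>
    {C \<in> carrier (End D) // green_L (End D). C \<subseteq> green_D (End D) `` {f}} \<approx> (UNIV :: nat set set)"
proof -
  have D: "digraph D" "countable (verts D)" "extension_property D"
    using assms(1) universal_digraph_extension_property[OF assms(1)] unfolding universal_digraph_def by blast+
  interpret monoid "End D"
    by (rule monoid_End[OF D(1)])
  obtain q where q: "digraph_hom D \<Gamma> q" "bij_betw q (verts D) (verts \<Gamma>)"
    using ex_bijective_hom[OF D assms(2-4)] by blast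
  have qV: "q x \<in> verts \<Gamma>" if "x \<in> verts D" for x
    using q(2) that by (auto simp: bij_betw_def)
  have qe: "(q x, q y) \<in> edges \<Gamma>" if "(x, y) \<in> edges D" for x y
    using q(1) that by (auto simp: digraph_hom_def)
  let ?t = "to_nat_on (verts \<Gamma>)"
  \<comment> \<open>Through \<open>?t\<close> a set of natural numbers is the same as a choice of
    one twin over each vertex of \<open>\<Gamma>\<close>.\<close>
  have t: "bij_betw ?t (verts \<Gamma>) UNIV"
    by (rule to_nat_on_infinite[OF assms(3) algebraically_closed_infinite[OF assms(2,4)]])
  define G :: "('b \<times> bool) digraph" where
    "G = (verts \<Gamma> \<times> UNIV, {((x, i), (y, j)). (x, y) \<in> edges \<Gamma>})"
  have G: "digraph G" "countable (verts G)"
    using assms(2,3) by (auto simp: digraph_def G_def irrefl_def)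
  obtain e where e: "digraph_embedding G D e"
    and ext: "\<And>p. digraph_hom G D p \<Longrightarrow> \<exists>h. digraph_hom D D h \<and> (\<forall>x\<in>verts G. h (e x) = p x)"
    using ex_embedding_extending_homs[OF D G] by blast
  have eV: "e (x, i) \<in> verts D" if "x \<in> verts \<Gamma>" for x i
    using e that by (auto simp: digraph_embedding_def G_def)
  have eI: "e (x, i) = e (y, j) \<longleftrightarrow> x = y \<and> i = j" if "x \<in> verts \<Gamma>" "y \<in> verts \<Gamma>" for x y i j
    using e inj_on_eq_iff[of e "verts G" "(x, i)" "(y, j)"] that
    by (simp add: digraph_embedding_def G_def)
  have eE: "(e (x, i), e (y, j)) \<in> edges D \<longleftrightarrow> (x, y) \<in> edges \<Gamma>"
    if "x \<in> verts \<Gamma>" "y \<in> verts \<Gamma>" for x y i j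
    using e that by (auto simp: digraph_embedding_def G_def)
  define f where "f S = (\<lambda>x\<in>verts D. e (q x, ?t (q x) \<in> S))" for S :: "nat set"
  have fx: "f S x = e (q x, ?t (q x) \<in> S)" if "x \<in> verts D" for S x
    using that by (simp add: f_def)
  have f: "f S \<in> carrier (End D)" for S
    unfolding f_def restrict_End_iff[OF D(1)] digraph_hom_def
    using eV qV eE qe digraph_edgeD[OF D(1)] by auto
  have R: "(f S, f T) \<in> green_R (End D)" for S T
  proof -
    have "\<exists>u\<in>carrier (End D). f T = f S \<otimes>\<^bsub>End D\<^esub> u" for S T
    proof -
      \<comment> \<open>Both twins over \<open>x\<close> go to the one selected by \<open>T\<close>.
        The tag \<open>i\<close> is ignored, so an extension sends \<open>f S\<close> to
        \<open>f T\<close> for every \<open>S\<close>.\<close>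
      have "digraph_hom G D (\<lambda>(x, i). e (x, ?t x \<in> T))"
        using eV eE digraph_edgeD[OF assms(2)] by (auto simp: digraph_hom_def G_def)
      then obtain h where h: "digraph_hom D D h"
        "\<And>x i. x \<in> verts \<Gamma> \<Longrightarrow> h (e (x, i)) = e (x, ?t x \<in> T)"
        using ext by (fastforce simp: G_def)
      have hc: "restrict h (verts D) \<in> carrier (End D)"
        using h(1) restrict_End_iff[OF D(1)] by blast
      have "f T = f S \<otimes>\<^bsub>End D\<^esub> restrict h (verts D)"
        by (rule End_eqI[OF f m_closed[OF f hc]]) (simp add: End_mult fx eV qV h)
      then show ?thesis
        using hc by blast
    qed
    then show ?thesis
      unfolding green_R_iff using f by (intro conjI) simp_all
  qed
  have sep: "S = T" if ST: "(f S, f T) \<in> green_L (End D)" for S T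
  proof -
    obtain u where u: "u \<in> carrier (End D)" "f T = u \<otimes>\<^bsub>End D\<^esub> f S"
      using ST unfolding green_L_iff by blast
    \<comment> \<open>The image of \<open>f T\<close> lies in that of \<open>f S\<close>, which
      contains just one twin over \<open>y\<close>; so the two selections agree there.\<close>
    have "?t y \<in> S \<longleftrightarrow> ?t y \<in> T" if y: "y \<in> verts \<Gamma>" for y
    proof -
      obtain x where x: "x \<in> verts D" "y = q x"
        using q(2) y by (auto simp: bij_betw_def)
      have "f T x = f S (u x)"
        using u(2) x(1) by (simp add: End_mult)
      then show ?thesis
        using x End_apply_closed[OF u(1) x(1)] by (auto simp: fx eI qV)
    qed
    then have "\<forall>n\<in>?t ` verts \<Gamma>. n \<in> S \<longleftrightarrow> n \<in> T"
      by blast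
    then show ?thesis
      unfolding bij_betw_imp_surj_on[OF t] by blast
  qed
  have inj: "inj_on (f {}) (verts D)"
    using q(2) by (auto simp: inj_on_def fx eI qV bij_betw_def)
  have im: "f {} ` verts D = (\<lambda>y. e (y, False)) ` verts \<Gamma>"
    using q(2) by (force simp: bij_betw_def fx)
  have "digraph_iso \<Gamma> (induced_subgraph D (f {} ` verts D)) (\<lambda>y. e (y, False))"
    unfolding im digraph_iso_def induced_subgraph_def
    using eI eE by (auto simp: bij_betw_def inj_on_def)
  then have iso: "isomorphic (induced_subgraph D (f {} ` verts D)) \<Gamma>"
    using isomorphic_sym unfolding isomorphic_def by blast
  have "\<not> regular_element (End D) (f {})"
  proof
    assume "regular_element (End D) (f {})"
    then obtain g where g: "g \<in> carrier (End D)" "f {} \<otimes>\<^bsub>End D\<^esub> g \<otimes>\<^bsub>End D\<^esub> f {} = f {}"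
      by (auto simp: regular_element_def)
    \<comment> \<open>Since \<open>f {}\<close> is injective, \<open>g\<close> inverts it on its
      image. As \<open>g\<close> preserves edges, edges of the copy of \<open>\<Gamma>\<close> pull
      back to \<open>D\<close>, which makes \<open>q\<close> reflect edges.\<close>
    have gf: "g (f {} x) = x" if x: "x \<in> verts D" for x
    proof (rule inj_onD[OF inj])
      show "f {} (g (f {} x)) = f {} x"
        using arg_cong[OF g(2), of "\<lambda>k. k x"] x by (simp add: End_mult)
    qed (use x End_apply_closed[OF g(1) End_apply_closed[OF f x]] in auto)
    have "(x, y) \<in> edges D" if xy: "x \<in> verts D" "y \<in> verts D" "(q x, q y) \<in> edges \<Gamma>" for x y
    proof -
      have "(f {} x, f {} y) \<in> edges D"
        using xy by (simp add: fx eE qV)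
      then have "(g (f {} x), g (f {} y)) \<in> edges D"
        using g(1) by (auto simp: End_carrier_iff digraph_hom_def)
      then show ?thesis
        using xy by (simp add: gf)
    qed
    then have "digraph_iso D \<Gamma> q"
      using q(2) qe by (auto simp: digraph_iso_def)
    then show False
      using assms(5) isomorphic_sym unfolding isomorphic_def by blast
  qed
  moreover have "{C \<in> carrier (End D) // green_L (End D). C \<subseteq> green_D (End D) `` {f {}}} \<approx> (UNIV :: nat set set)"
  proof (rule classes_eqpoll_continuum[where F = f])
    show "carrier (End D) \<lesssim> (UNIV :: nat set set)"
      by (rule End_lepoll_continuum[OF D(2)])
    show "(f S, f S) \<in> green_L (End D)" for S
      using f by (simp add: green_L_def)
    \<comment> \<open>All \<open>f S\<close> are \<open>\<R>\<close>-related to \<open>f {}\<close>,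
      so their \<open>\<L>\<close>-classes lie in its \<open>\<D>\<close>-class.\<close>
    show "green_L (End D) `` {f S} \<subseteq> green_D (End D) `` {f {}}" for S
      using green_R_L_imp_green_D[OF R] by blast
  qed (use f sep in auto)
  ultimately show ?thesis
    using f[of "{}"] inj iso R_classes_of_injective_endomorphism[OF D f inj] by blast
qed

end
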